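(* Let $\{\phi_t\}_{t\ge0}$ be a one-parameter semigroup of analytic self-maps of the unit disk $\mathbb{D}$, and let $A$ be the disk algebra. Then $\{\phi_t\}\subset A$ (that is, $\phi_t\in A$ for all $t\ge0$) if and only if $[\phi_t,A]=A$.
   Context: $\mathbb{D}=\{z\in\mathbb{C}:|z|<1\}$ and $H(\mathbb{D})$ is the set of analytic functions on $\mathbb{D}$. The disk algebra $A$ is the space of bounded analytic functions on $\mathbb{D}$ that extend to be continuous on $\overline{\mathbb{D}}$, with norm $\|f\|_\infty=\sup_{z\in\mathbb{D}}|f(z)|$. A one-parameter semigroup $\{\phi_t\}_{t\ge0}$ of analytic functions on $\mathbb{D}$ is a family of analytic functions $\phi_t:\mathbb{D}\to\mathbb{D}$ such that: $\phi_0(z)=z$ for $z\in\mathbb{D}$; $\phi_{s+t}=\phi_s\circ\phi_t$ for all $s,t\ge0$; and $(t,z)\mapsto\phi_t(z)$ is continuous on $[0,\infty)\times\mathbb{D}$. Put $C_t(f)=f\circ\phi_t$ for $f\in H(\mathbb{D})$. The semigroup acts on $A$ if $C_t$ is a bounded operator on $A$ for every $t\ge0$; in that case $[\phi_t,A]$ denotes the maximal closed subspace of $A$ on which $\{C_t\}$ is strongly continuous, i.e. on which $\lim_{t\to0^+}\|f\circ\phi_t-f\|_\infty=0$ for every element $f$. The statement $[\phi_t,A]=A$ thus means that $\{\phi_t\}$ acts on $A$ and $\lim_{t\to0^+}\|f\circ\phi_t-f\|_\infty=0$ for all $f\in A$. *)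

theory Defs
  imports "HOL-Complex_Analysis.Complex_Analysis"
begin

abbreviation unit_disk :: "complex set" where
  "unit_disk \<equiv> ball 0 1"

text \<open>
  A function on the disk is represented by a total function of type
  \<^typ>\<open>complex \<Rightarrow> complex\<close> whose values off the disk are irrelevant: \<open>disk_algebra\<close>
  and \<open>disk_norm\<close> only look at values on the open disk. Hence \<open>disk_norm\<close> is a seminorm
  on total functions, and its kernel consists of the functions that vanish on the disk.
\<close>

definition disk_algebra :: "(complex \<Rightarrow> complex) set" where
  "disk_algebra = {f. f holomorphic_on unit_disk \<and> bounded (f ` unit_disk) \<and>
     (\<exists>g. continuous_on (closure unit_disk) g \<and> (\<forall>z\<in>unit_disk. g z = f z))}"

definition disk_norm :: "(complex \<Rightarrow> complex) \<Rightarrow> real" where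
  "disk_norm f = (SUP z\<in>unit_disk. norm (f z))"

definition disk_semigroup :: "(real \<Rightarrow> complex \<Rightarrow> complex) \<Rightarrow> bool" where
  "disk_semigroup \<phi> \<longleftrightarrow>
     (\<forall>t\<ge>0. \<phi> t holomorphic_on unit_disk \<and> \<phi> t ` unit_disk \<subseteq> unit_disk) \<and>
     (\<forall>z\<in>unit_disk. \<phi> 0 z = z) \<and>
     (\<forall>s\<ge>0. \<forall>t\<ge>0. \<forall>z\<in>unit_disk. \<phi> (s + t) z = \<phi> s (\<phi> t z)) \<and>
     continuous_on ({0..} \<times> unit_disk) (\<lambda>(t, z). \<phi> t z)"

definition comp_op ::
  "(real \<Rightarrow> complex \<Rightarrow> complex) \<Rightarrow> real \<Rightarrow> (complex \<Rightarrow> complex) \<Rightarrow> complex \<Rightarrow> complex" where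
  "comp_op \<phi> t f = f \<circ> \<phi> t"

definition bounded_operator_on_disk_algebra ::
  "((complex \<Rightarrow> complex) \<Rightarrow> complex \<Rightarrow> complex) \<Rightarrow> bool" where
  "bounded_operator_on_disk_algebra T \<longleftrightarrow>
     T ` disk_algebra \<subseteq> disk_algebra \<and>
     (\<forall>f\<in>disk_algebra. \<forall>g\<in>disk_algebra. \<forall>z\<in>unit_disk. T (\<lambda>w. f w + g w) z = T f z + T g z) \<and>
     (\<forall>c. \<forall>f\<in>disk_algebra. \<forall>z\<in>unit_disk. T (\<lambda>w. c * f w) z = c * T f z) \<and>
     (\<exists>K. \<forall>f\<in>disk_algebra. disk_norm (T f) \<le> K * disk_norm f)"

definition acts_on_disk_algebra :: "(real \<Rightarrow> complex \<Rightarrow> complex) \<Rightarrow> bool" where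
  "acts_on_disk_algebra \<phi> \<longleftrightarrow> (\<forall>t\<ge>0. bounded_operator_on_disk_algebra (comp_op \<phi> t))"

definition closed_subspace_of_disk_algebra :: "(complex \<Rightarrow> complex) set \<Rightarrow> bool" where
  "closed_subspace_of_disk_algebra M \<longleftrightarrow>
     M \<subseteq> disk_algebra \<and>
     (\<lambda>z. 0) \<in> M \<and>
     (\<forall>f\<in>M. \<forall>g\<in>M. (\<lambda>z. f z + g z) \<in> M) \<and>
     (\<forall>c. \<forall>f\<in>M. (\<lambda>z. c * f z) \<in> M) \<and>
     (\<forall>F. \<forall>f\<in>disk_algebra. (\<forall>n::nat. F n \<in> M) \<and>
        (\<lambda>n. disk_norm (\<lambda>z. F n z - f z)) \<longlonglongrightarrow> 0 \<longrightarrow> f \<in> M)"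

definition strongly_continuous_on ::
  "(real \<Rightarrow> complex \<Rightarrow> complex) \<Rightarrow> (complex \<Rightarrow> complex) set \<Rightarrow> bool" where
  "strongly_continuous_on \<phi> M \<longleftrightarrow>
     (\<forall>f\<in>M. ((\<lambda>t. disk_norm (\<lambda>z. comp_op \<phi> t f z - f z)) \<longlongrightarrow> 0) (at_right 0))"

text \<open>
  The space written \<open>[\<phi>\<^sub>t, A]\<close>. That the greatest element exists is
  \<open>strong_continuity_space_greatest\<close> below.
\<close>

definition strong_continuity_space ::
  "(real \<Rightarrow> complex \<Rightarrow> complex) \<Rightarrow> (complex \<Rightarrow> complex) set" where
  "strong_continuity_space \<phi> =
     (GREATEST M. closed_subspace_of_disk_algebra M \<and> strongly_continuous_on \<phi> M)"

lemma disk_norm_upper: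
  assumes "bounded (f ` unit_disk)" "z \<in> unit_disk"
  shows "norm (f z) \<le> disk_norm f"
  unfolding disk_norm_def
proof (rule cSUP_upper[OF assms(2)])
  show "bdd_above ((\<lambda>z. norm (f z)) ` unit_disk)"
    using assms(1) by (auto simp: bounded_iff bdd_above_def)
qed

lemma disk_norm_least:
  assumes "\<And>z. z \<in> unit_disk \<Longrightarrow> norm (f z) \<le> K"
  shows "disk_norm f \<le> K"
  unfolding disk_norm_def by (rule cSUP_least) (use assms in auto)

lemma disk_norm_nonneg:
  assumes "bounded (f ` unit_disk)"
  shows "0 \<le> disk_norm f"
  using disk_norm_upper[OF assms, of 0] norm_ge_zero[of "f 0"]
  by (metis centre_in_ball order_trans zero_less_one)

lemma disk_algebra_bounded: "f \<in> disk_algebra \<Longrightarrow> bounded (f ` unit_disk)"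
  by (simp add: disk_algebra_def)

lemma disk_algebra_zero: "(\<lambda>z. 0) \<in> disk_algebra"
  unfolding disk_algebra_def by (auto intro!: exI[of _ "\<lambda>z. 0"] simp: image_constant_conv)

lemma disk_algebra_add:
  assumes "f \<in> disk_algebra" "g \<in> disk_algebra"
  shows "(\<lambda>z. f z + g z) \<in> disk_algebra"
proof -
  obtain f' g' where "continuous_on (closure unit_disk) f'" "\<forall>z\<in>unit_disk. f' z = f z"
    "continuous_on (closure unit_disk) g'" "\<forall>z\<in>unit_disk. g' z = g z"
    using assms unfolding disk_algebra_def by blast
  then have "\<exists>h. continuous_on (closure unit_disk) h \<and> (\<forall>z\<in>unit_disk. h z = f z + g z)"
    by (intro exI[of _ "\<lambda>z. f' z + g' z"]) (auto intro: continuous_on_add)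
  then show ?thesis
    using assms by (auto simp: disk_algebra_def intro: holomorphic_on_add bounded_plus_comp)
qed

lemma disk_algebra_scale:
  assumes "f \<in> disk_algebra"
  shows "(\<lambda>z. c * f z) \<in> disk_algebra"
proof -
  obtain f' where "continuous_on (closure unit_disk) f'" "\<forall>z\<in>unit_disk. f' z = f z"
    using assms unfolding disk_algebra_def by blast
  then have "\<exists>h. continuous_on (closure unit_disk) h \<and> (\<forall>z\<in>unit_disk. h z = c * f z)"
    by (intro exI[of _ "\<lambda>z. c * f' z"]) (auto intro: continuous_on_mult_left)
  moreover have "bounded ((\<lambda>z. c * f z) ` unit_disk)"
    using bounded_linear_image[OF disk_algebra_bounded[OF assms] bounded_linear_mult_right[of c]]
    by (simp add: image_image)
  ultimately show ?thesis
    using assms by (auto simp: disk_algebra_def intro: holomorphic_on_mult)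
qed

lemma bounded_comp_diff:
  assumes "disk_semigroup \<phi>" "t \<ge> 0" "f \<in> disk_algebra"
  shows "bounded ((\<lambda>z. comp_op \<phi> t f z - f z) ` unit_disk)"
proof -
  obtain B where B: "\<And>z. z \<in> unit_disk \<Longrightarrow> norm (f z) \<le> B"
    using disk_algebra_bounded[OF assms(3)] unfolding bounded_iff by blast
  have "norm (comp_op \<phi> t f z - f z) \<le> B + B" if "z \<in> unit_disk" for z
    using B[OF that] B[of "\<phi> t z"] assms(1,2) that norm_triangle_ineq4[of "f (\<phi> t z)" "f z"]
    unfolding disk_semigroup_def comp_op_def by fastforce
  then show ?thesis unfolding bounded_iff by blast
qed

lemma strong_continuity_space_greatest:
  fixes \<phi> :: "real \<Rightarrow> complex \<Rightarrow> complex"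
  assumes sg: "disk_semigroup \<phi>"
  defines "S \<equiv> {f \<in> disk_algebra.
    ((\<lambda>t. disk_norm (\<lambda>z. comp_op \<phi> t f z - f z)) \<longlongrightarrow> 0) (at_right 0)}"
  shows "closed_subspace_of_disk_algebra S" "strongly_continuous_on \<phi> S"
    "\<And>M. closed_subspace_of_disk_algebra M \<Longrightarrow> strongly_continuous_on \<phi> M \<Longrightarrow> M \<subseteq> S"
proof -
  let ?D = "\<lambda>f t. disk_norm (\<lambda>z. comp_op \<phi> t f z - f z)"
  have maps: "\<phi> t z \<in> unit_disk" if "t \<ge> 0" "z \<in> unit_disk" for t z
    using sg that unfolding disk_semigroup_def by blast
  have le: "norm (f (\<phi> t z) - f z) \<le> ?D f t"
    if "t \<ge> 0" "f \<in> disk_algebra" "z \<in> unit_disk" for t f z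
    using disk_norm_upper[OF bounded_comp_diff[OF sg that(1,2)] that(3)] by (simp add: comp_op_def)
  have ge0: "0 \<le> ?D f t" if "t \<ge> 0" "f \<in> disk_algebra" for t f
    using disk_norm_nonneg[OF bounded_comp_diff[OF sg that]] .
  have ev: "eventually (\<lambda>t::real. t > 0) (at_right 0)"
    by (simp add: eventually_at_right_less)
  have lim_le: "(?D f \<longlongrightarrow> 0) (at_right 0)"
    if f: "f \<in> disk_algebra" and le: "\<And>t. t > 0 \<Longrightarrow> ?D f t \<le> h t" and h: "(h \<longlongrightarrow> 0) (at_right 0)"
    for f h
    by (rule tendsto_sandwich[OF _ _ tendsto_const h])
       (use ev in \<open>eventually_elim, use ge0 f le in auto\<close>)+
  show "closed_subspace_of_disk_algebra S"
    unfolding closed_subspace_of_disk_algebra_def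
  proof (intro conjI ballI allI impI)
    show "S \<subseteq> disk_algebra" by (auto simp: S_def)
    show "(\<lambda>z. 0) \<in> S"
      by (auto simp: S_def disk_algebra_zero comp_op_def disk_norm_def)
  next
    fix f g assume f: "f \<in> S" and g: "g \<in> S"
    have "(?D (\<lambda>z. f z + g z) \<longlongrightarrow> 0) (at_right 0)"
    proof (rule lim_le)
      show "((\<lambda>t. ?D f t + ?D g t) \<longlongrightarrow> 0) (at_right 0)"
        using f g by (auto simp: S_def intro: tendsto_add_zero)
      show "(\<lambda>z. f z + g z) \<in> disk_algebra"
        using f g by (auto simp: S_def intro: disk_algebra_add)
      fix t :: real assume t: "t > 0"
      show "?D (\<lambda>z. f z + g z) t \<le> ?D f t + ?D g t"
      proof (rule disk_norm_least)
        fix z assume z: "z \<in> unit_disk"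
        have "norm (f (\<phi> t z) - f z) \<le> ?D f t" "norm (g (\<phi> t z) - g z) \<le> ?D g t"
          using f g t z by (auto simp: S_def intro!: le)
        then show "norm (comp_op \<phi> t (\<lambda>z. f z + g z) z - (f z + g z)) \<le> ?D f t + ?D g t"
          using norm_triangle_ineq[of "f (\<phi> t z) - f z" "g (\<phi> t z) - g z"]
          by (simp add: comp_op_def algebra_simps)
      qed
    qed
    then show "(\<lambda>z. f z + g z) \<in> S"
      using f g by (auto simp: S_def intro: disk_algebra_add)
  next
    fix c f assume f: "f \<in> S"
    have "(?D (\<lambda>z. c * f z) \<longlongrightarrow> 0) (at_right 0)"
    proof (rule lim_le)
      show "((\<lambda>t. norm c * ?D f t) \<longlongrightarrow> 0) (at_right 0)"
        using f by (auto simp: S_def intro: tendsto_mult_right_zero)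
      show "(\<lambda>z. c * f z) \<in> disk_algebra"
        using f by (auto simp: S_def intro: disk_algebra_scale)
      fix t :: real assume t: "t > 0"
      show "?D (\<lambda>z. c * f z) t \<le> norm c * ?D f t"
      proof (rule disk_norm_least)
        fix z assume z: "z \<in> unit_disk"
        have "norm (f (\<phi> t z) - f z) \<le> ?D f t"
          using f t z by (auto simp: S_def intro!: le)
        then have "norm c * norm (f (\<phi> t z) - f z) \<le> norm c * ?D f t"
          by (intro mult_left_mono) auto
        then show "norm (comp_op \<phi> t (\<lambda>z. c * f z) z - c * f z) \<le> norm c * ?D f t"
          by (simp add: comp_op_def flip: norm_mult right_diff_distrib)
      qed
    qed
    then show "(\<lambda>z. c * f z) \<in> S"
      using f by (auto simp: S_def intro: disk_algebra_scale)
  next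
    fix F :: "nat \<Rightarrow> complex \<Rightarrow> complex" and f
    assume f: "f \<in> disk_algebra"
      and *: "(\<forall>n. F n \<in> S) \<and> (\<lambda>n. disk_norm (\<lambda>z. F n z - f z)) \<longlonglongrightarrow> 0"
    have "(?D f \<longlongrightarrow> 0) (at_right 0)"
    proof (rule tendstoI)
      fix e :: real assume e: "e > 0"
      have "eventually (\<lambda>n. disk_norm (\<lambda>z. F n z - f z) < e / 4) sequentially"
        using order_tendstoD(2)[OF conjunct2[OF *], of "e / 4"] e by simp
      then obtain n where n: "disk_norm (\<lambda>z. F n z - f z) < e / 4"
        using eventually_happens'[OF sequentially_bot] by blast
      have Fn: "F n \<in> disk_algebra" "(?D (F n) \<longlongrightarrow> 0) (at_right 0)"
        using * by (auto simp: S_def)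
      have bd: "bounded ((\<lambda>z. F n z - f z) ` unit_disk)"
        by (intro bounded_minus_comp disk_algebra_bounded f Fn)
      have nn: "norm (F n z - f z) \<le> e / 4" if "z \<in> unit_disk" for z
        using disk_norm_upper[OF bd that] n by simp
      have "eventually (\<lambda>t. ?D (F n) t < e / 4) (at_right 0)"
        using order_tendstoD(2)[OF Fn(2), of "e / 4"] e by simp
      with ev show "eventually (\<lambda>t. dist (?D f t) 0 < e) (at_right 0)"
      proof eventually_elim
        case (elim t)
        have "?D f t \<le> 3 * (e / 4)"
        proof (rule disk_norm_least)
          fix z assume z: "z \<in> unit_disk"
          have 1: "norm (F n (\<phi> t z) - F n z) \<le> e / 4"
            using le[of t "F n" z] elim Fn z by simp
          have 2: "norm (F n (\<phi> t z) - f (\<phi> t z)) \<le> e / 4"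
            using elim z by (intro nn maps) auto
          have "f (\<phi> t z) - f z
            = (F n (\<phi> t z) - F n z) - (F n (\<phi> t z) - f (\<phi> t z)) + (F n z - f z)"
            by simp
          also have "norm \<dots> \<le> norm (F n (\<phi> t z) - F n z) + norm (F n (\<phi> t z) - f (\<phi> t z))
            + norm (F n z - f z)"
            by (meson add_mono norm_triangle_ineq norm_triangle_ineq4 order_refl order_trans)
          finally show "norm (comp_op \<phi> t f z - f z) \<le> 3 * (e / 4)"
            using 1 2 nn[OF z] by (simp add: comp_op_def)
        qed
        then show ?case
          using ge0[of t f] f elim e by (simp add: dist_norm)
      qed
    qed
    then show "f \<in> S" using f by (simp add: S_def)
  qed
  show "strongly_continuous_on \<phi> S"
    by (auto simp: strongly_continuous_on_def S_def)
  show "M \<subseteq> S" if "closed_subspace_of_disk_algebra M" "strongly_continuous_on \<phi> M" for M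
    using that
    by (auto simp: S_def closed_subspace_of_disk_algebra_def strongly_continuous_on_def)
qed

lemma strong_continuity_space_eq:
  assumes "disk_semigroup \<phi>"
  shows "strong_continuity_space \<phi> = {f \<in> disk_algebra.
    ((\<lambda>t. disk_norm (\<lambda>z. comp_op \<phi> t f z - f z)) \<longlongrightarrow> 0) (at_right 0)}"
  unfolding strong_continuity_space_def
  by (rule Greatest_equality) (use strong_continuity_space_greatest[OF assms] in auto)

end

theory Submission
  imports Defs
begin

text \<open>
  Every semigroup, with no regularity at the boundary, converges to the identity uniformly on the
  disk as \<open>t \<rightarrow> 0\<close>; uniform continuity of \<open>f \<in> A\<close> then gives strong continuity, and the converse
  follows by applying \<open>C\<^sub>t\<close> to the identity function.

  For uniform convergence, let \<open>h(z)\<close> be the integral of \<open>\<phi>\<^sub>u(z)\<close> over \<open>0 \<le> u \<le> a\<close>. Along an orbit \<open>h\<close>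
  has speed \<open>\<phi>\<^bsub>a+s\<^esub>(z) - \<phi>\<^sub>s(z)\<close>, which is at most 2 in modulus. So for every entire \<open>p\<close> a primitive
  \<open>W\<close> of \<open>p h'\<close> satisfies \<open>|W(\<phi>\<^sub>t(z)) - W(z)| \<le> K t\<close> with \<open>K\<close> independent of \<open>z\<close>. If convergence
  were not uniform, there would be \<open>t\<^sub>n \<rightarrow> 0\<close> and \<open>z\<^sub>n \<rightarrow> A\<close> with \<open>\<phi>\<close> at time \<open>t\<^sub>n\<close> moving \<open>z\<^sub>n\<close> to
  points tending to some \<open>B \<noteq> A\<close>, and \<open>h(z\<^sub>n) \<rightarrow> c\<close>. Integrating \<open>W\<close> by parts along segments and
  passing to the limit makes the integral of \<open>p' (h - c)\<close> over the chord from \<open>A\<close> to \<open>B\<close> vanish for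
  every polynomial \<open>p\<close>, so \<open>h = c\<close> on the chord and hence on the disk. But \<open>h'(0) \<noteq> 0\<close> for small \<open>a\<close>.
\<close>

section \<open>Functions on the unit interval with vanishing moments\<close>

text \<open>By Weierstrass, some polynomial \<open>g\<close> is within \<open>e\<close> of
  \<open>v\<close>. Vanishing moments make the integral of \<open>g * v\<close> zero, so the
  integral of \<open>v * v\<close> equals that of \<open>(v - g) * v\<close>, which is at most
  \<open>e\<close> times the bound \<open>M\<close> of \<open>v\<close>. Hence the continuous
  function \<open>v * v\<close> has integral zero.\<close>

lemma vanishing_moments_real:
  fixes v :: "real \<Rightarrow> real"
  assumes v: "continuous_on {0..1} v"
    and mom: "\<And>k. ((\<lambda>x. x ^ k * v x) has_integral 0) {0..1}"
    and x: "x \<in> {0..1}"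
  shows "v x = 0"
proof -
  have "compact (v ` {0..1})"
    using v by (intro compact_continuous_image) auto
  then obtain M where M: "\<And>x. x \<in> {0..1} \<Longrightarrow> \<bar>v x\<bar> \<le> M"
    using compact_imp_bounded[of "v ` {0..1}"] unfolding bounded_iff by fastforce
  have M0: "M \<ge> 0" using M[of 0] by simp
  have int: "(\<lambda>x. v x * v x) integrable_on {0..1}"
    by (intro integrable_continuous_real continuous_intros v)
  have small: "integral {0..1} (\<lambda>x. v x * v x) \<le> e * M" if e: "e > 0" for e
  proof -
    obtain g where g: "real_polynomial_function g" "\<And>x. x \<in> {0..1} \<Longrightarrow> \<bar>v x - g x\<bar> < e"
      using Stone_Weierstrass_real_polynomial_function[OF compact_Icc v e] by blast
    obtain a n where an: "g = (\<lambda>x. \<Sum>i\<le>(n::nat). a i * x ^ i)"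
      using g(1) unfolding real_polynomial_function_iff_sum by auto
    have "((\<lambda>x. \<Sum>i\<le>n. a i * (x ^ i * v x)) has_integral (\<Sum>i\<le>n. a i * 0)) {0..1}"
      by (intro has_integral_sum has_integral_mult_right mom) auto
    then have "((\<lambda>x. g x * v x) has_integral 0) {0..1}"
      by (simp add: an sum_distrib_right mult.assoc)
    from has_integral_diff[OF integrable_integral[OF int] this]
    have i: "((\<lambda>x. (v x - g x) * v x) has_integral integral {0..1} (\<lambda>x. v x * v x)) {0..1}"
      by (simp add: algebra_simps)
    have "integral {0..1} (\<lambda>x. v x * v x) \<le> e * M * (1 - 0)"
    proof (rule has_integral_le[OF i])
      show "((\<lambda>x. e * M) has_integral e * M * (1 - 0)) {0..1::real}"
        using has_integral_const_real[of "e * M" 0 1] by simp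
      fix x :: real assume x: "x \<in> {0..1}"
      have "(v x - g x) * v x \<le> \<bar>v x - g x\<bar> * \<bar>v x\<bar>"
        by (metis abs_ge_self abs_mult)
      also have "\<dots> \<le> e * M"
        using g(2)[OF x] M[OF x] that by (intro mult_mono) auto
      finally show "(v x - g x) * v x \<le> e * M" .
    qed
    then show ?thesis by simp
  qed
  have "integral {0..1} (\<lambda>x. v x * v x) \<le> 0"
  proof (rule field_le_epsilon)
    fix e :: real assume "e > 0"
    \<comment> \<open>The denominator is \<open>M + 1\<close> because \<open>M\<close> may be
      0.\<close>
    then have "e / (M + 1) * M \<le> e"
      using M0 by (simp add: divide_simps mult_left_mono)
    with small[of "e / (M + 1)"] M0 \<open>e > 0\<close>
    show "integral {0..1} (\<lambda>x. v x * v x) \<le> 0 + e" by simp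
  qed
  moreover have "integral {0..1} (\<lambda>x. v x * v x) \<ge> 0"
    by (intro integral_nonneg int) auto
  ultimately have int0: "integral {0..1} (\<lambda>x. v x * v x) = 0" by simp
  have "continuous_on {0..1} (\<lambda>x. v x * v x)"
    by (intro continuous_intros v)
  then have "\<forall>x\<in>{0..1}. v x * v x = 0"
    using integral_eq_0_iff[of 0 1 "\<lambda>x. v x * v x"] int0 by simp
  then have "v x * v x = 0" using x by (rule bspec)
  then show ?thesis by simp
qed

text \<open>
  The factor \<open>x (1 - x)\<close> below extends \<open>u\<close> continuously to the end points and only shifts the moments.
\<close>

lemma vanishing_moments_Re:
  fixes u :: "real \<Rightarrow> complex"
  assumes u: "continuous_on {0<..<1} u"
    and B: "\<And>x. x \<in> {0<..<1} \<Longrightarrow> norm (u x) \<le> B"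
    and mom: "\<And>k. ((\<lambda>x. of_real x ^ k * u x) has_integral 0) {0<..<1}"
    and x: "x \<in> {0<..<1}"
  shows "Re (u x) = 0"
proof -
  define v where "v = (\<lambda>x. x * (1 - x) * Re (u x))"
  have cont: "continuous_on {0<..<1} v"
    unfolding v_def by (intro continuous_intros u)
  have B0: "B \<ge> 0" using B[OF x] norm_ge_zero order_trans by blast
  \<comment> \<open>The bound holds at the end points too, whatever the values of \<open>u\<close>
    there, and squeezes \<open>v\<close> to 0.\<close>
  have bnd: "norm (v y) \<le> y * (1 - y) * B" if "y \<in> {0..1}" for y
  proof (cases "y \<in> {0<..<1}")
    case True
    then have "\<bar>Re (u y)\<bar> \<le> B" using B[of y] abs_Re_le_cmod[of "u y"] by linarith
    then have "y * (1 - y) * \<bar>Re (u y)\<bar> \<le> y * (1 - y) * B"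
      using True by (intro mult_left_mono) auto
    then show ?thesis using True by (simp add: v_def abs_mult)
  next
    case False
    then have "y = 0 \<or> y = 1" using that by auto
    then show ?thesis by (auto simp: v_def)
  qed
  have "continuous_on {0..1} v"
    unfolding continuous_on_eq_continuous_within
  proof
    fix y :: real assume y: "y \<in> {0..1}"
    show "continuous (at y within {0..1}) v"
    proof (cases "y \<in> {0<..<1}")
      case True
      then have "isCont v y" using cont by (simp add: continuous_on_eq_continuous_at)
      then show ?thesis using continuous_at_imp_continuous_at_within by blast
    next
      case False
      then have y01: "y * (1 - y) = 0" "v y = 0" using y by (auto simp: v_def)
      have "((\<lambda>y. y * (1 - y) * B) \<longlongrightarrow> y * (1 - y) * B) (at y within {0..1})"
        by (intro tendsto_intros)
      then have lim: "((\<lambda>y. y * (1 - y) * B) \<longlongrightarrow> 0) (at y within {0..1})"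
        by (simp only: y01 mult_zero_left)
      have "eventually (\<lambda>y. norm (v y) \<le> y * (1 - y) * B) (at y within {0..1})"
        unfolding eventually_at_filter by (intro always_eventually allI impI bnd)
      then have "(v \<longlongrightarrow> 0) (at y within {0..1})"
        using lim by (rule Lim_null_comparison)
      then show ?thesis using y01 by (simp add: continuous_within)
    qed
  qed
  moreover have "((\<lambda>x. x ^ k * v x) has_integral 0) {0..1}" for k
  proof -
    have "((\<lambda>x. Re (of_real x ^ Suc k * u x - of_real x ^ Suc (Suc k) * u x)) has_integral Re (0 - 0)) {0<..<1}"
      by (intro has_integral_Re has_integral_diff mom)
    moreover have "Re (of_real x ^ Suc k * u x - of_real x ^ Suc (Suc k) * u x) = x ^ k * v x" for x :: real
    proof -
      have "of_real x ^ Suc k * u x - of_real x ^ Suc (Suc k) * u x = of_real (x ^ k * (x * (1 - x))) * u x"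
        by (simp add: algebra_simps)
      then show ?thesis by (simp add: v_def algebra_simps)
    qed
    ultimately show ?thesis by (simp add: has_integral_Icc_iff_Ioo)
  qed
  ultimately have "v x = 0" using x by (intro vanishing_moments_real) auto
  then show ?thesis using x by (simp add: v_def)
qed

text \<open>The real-part version also applies to \<open>\<i> * u\<close>, whose real part is minus
  the imaginary part of \<open>u\<close>.\<close>

lemma vanishing_moments:
  fixes u :: "real \<Rightarrow> complex"
  assumes u: "continuous_on {0<..<1} u"
    and B: "\<And>x. x \<in> {0<..<1} \<Longrightarrow> norm (u x) \<le> B"
    and mom: "\<And>k. ((\<lambda>x. of_real x ^ k * u x) has_integral 0) {0<..<1}"
    and x: "x \<in> {0<..<1}"
  shows "u x = 0"
proof -
  have "Re (u x) = 0"
    using vanishing_moments_Re[OF assms] .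
  moreover have "Re (\<i> * u x) = 0"
  proof (rule vanishing_moments_Re[OF _ _ _ x])
    show "((\<lambda>x. of_real x ^ k * (\<i> * u x)) has_integral 0) {0<..<1}" for k
      using has_integral_mult_right[OF mom[of k], of \<i>] by (simp add: mult.left_commute)
  qed (use u B in \<open>auto intro: continuous_intros simp: norm_mult\<close>)
  ultimately show ?thesis by (simp add: complex_eq_iff)
qed

section \<open>Holomorphic functions vanishing on a chord\<close>

text \<open>Strict convexity of the disk: an interior point of a segment is strictly closer to 0
  than one of the two ends.\<close>

lemma linepath_in_ball:
  fixes A B :: complex
  assumes "A \<in> cball 0 1" "B \<in> cball 0 1" "A \<noteq> B" "x \<in> {0<..<1}"
  shows "linepath A B x \<in> ball 0 1"
proof -
  have "linepath A B x \<in> open_segment A B"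
    using assms by (auto simp: in_segment linepath_def)
  from dist_decreases_open_segment[OF this, of 0]
  have "norm (linepath A B x) < norm A \<or> norm (linepath A B x) < norm B"
    by (simp add: dist_norm)
  then show ?thesis using assms by auto
qed

text \<open>
  With \<open>p z = (z - A)^(k+1)/(k+1)\<close>, integration by parts along the segment from
  \<open>a n\<close> to \<open>b n\<close> turns the hypothesis into the vanishing of the moments of \<open>g\<close> on the chord
  from \<open>A\<close> to \<open>B\<close>.
\<close>

lemma eq_0_if_vanishing_on_chord:
  fixes g :: "complex \<Rightarrow> complex" and a b :: "nat \<Rightarrow> complex"
  assumes g: "g holomorphic_on ball 0 1"
    and M: "\<And>z. z \<in> ball 0 1 \<Longrightarrow> norm (g z) \<le> M"
    and ab: "\<And>n. a n \<in> ball 0 1" "\<And>n. b n \<in> ball 0 1"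
    and lim: "a \<longlonglongrightarrow> A" "b \<longlonglongrightarrow> B" and AB: "A \<noteq> B"
    and ga: "(\<lambda>n. g (a n)) \<longlonglongrightarrow> 0" and gb: "(\<lambda>n. g (b n)) \<longlonglongrightarrow> 0"
    and W: "\<And>p W. p holomorphic_on UNIV \<Longrightarrow>
      (\<And>z. z \<in> ball 0 1 \<Longrightarrow> (W has_field_derivative p z * deriv g z) (at z)) \<Longrightarrow>
      (\<lambda>n. W (b n) - W (a n)) \<longlonglongrightarrow> 0"
    and z: "z \<in> ball 0 1"
  shows "g z = 0"
proof -
  have "norm A \<le> 1"
    by (rule Lim_norm_ubound[OF sequentially_bot lim(1)]) (use ab(1) in \<open>simp add: less_imp_le\<close>)
  moreover have "norm B \<le> 1"
    by (rule Lim_norm_ubound[OF sequentially_bot lim(2)]) (use ab(2) in \<open>simp add: less_imp_le\<close>)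
  ultimately have AB1: "A \<in> cball 0 1" "B \<in> cball 0 1" by simp_all
  have cg: "continuous_on (ball 0 1) g" using g by (rule holomorphic_on_imp_continuous_on)
  have seg: "linepath A B x \<in> ball 0 1" if "x \<in> {0<..<1}" for x
    using linepath_in_ball[OF AB1 AB that] .
  have segn: "linepath (a n) (b n) x \<in> ball 0 1" if "x \<in> {0..1}" for x n
  proof -
    have "linepath (a n) (b n) x \<in> closed_segment (a n) (b n)"
      using that by (auto simp: linepath_in_path)
    then show ?thesis using ab closed_segment_subset[OF ab(1) ab(2) convex_ball] by blast
  qed
  define u where "u = (\<lambda>x. g (linepath A B x))"
  have mom: "((\<lambda>x. of_real x ^ k * u x) has_integral 0) {0<..<1}" for k
  proof -
    define p where "p = (\<lambda>z. (z - A) ^ Suc k / of_nat (Suc k))"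
    have p': "(p has_field_derivative (z - A) ^ k) (at z)" for z
    proof -
      have "(p has_field_derivative (of_nat (Suc k) * (z - A) ^ k / of_nat (Suc k))) (at z)"
        unfolding p_def
        using DERIV_power_Suc[of "\<lambda>z. z - A" 1 z UNIV k]
        by (intro DERIV_cdivide) (auto intro!: derivative_eq_intros simp del: of_nat_Suc power_Suc)
      then show ?thesis by (simp del: of_nat_Suc)
    qed
    have hp: "p holomorphic_on UNIV"
      using p' by (auto simp: holomorphic_on_def field_differentiable_def)
    define q where "q = (\<lambda>z. (z - A) ^ k * g z)"
    have hq: "q holomorphic_on ball 0 1" unfolding q_def by (intro holomorphic_intros g)
    obtain V where V: "\<And>z. z \<in> ball 0 1 \<Longrightarrow> (V has_field_derivative q z) (at z within ball 0 1)"
      using holomorphic_convex_primitive'[OF convex_ball open_ball hq] by metis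
    \<comment> \<open>\<open>V\<close> is a primitive of \<open>p' g\<close>, so
      \<open>p g - V\<close> is a primitive of \<open>p g'\<close> and the hypothesis
      \<open>W\<close> applies to it.\<close>
    have W0: "(\<lambda>n. (p (b n) * g (b n) - V (b n)) - (p (a n) * g (a n) - V (a n))) \<longlonglongrightarrow> 0"
    proof (rule W[OF hp, of "\<lambda>z. p z * g z - V z"])
      fix z :: complex assume z: "z \<in> ball 0 1"
      have V': "(V has_field_derivative q z) (at z)"
        using V[OF z] at_within_open[OF z open_ball] by simp
      have g': "(g has_field_derivative deriv g z) (at z)"
        by (rule holomorphic_derivI[OF g open_ball z])
      have "(z - A) ^ k * g z + deriv g z * p z - q z = p z * deriv g z"
        by (simp add: q_def)
      with DERIV_diff[OF DERIV_mult[OF p' g'] V']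
      show "((\<lambda>z. p z * g z - V z) has_field_derivative p z * deriv g z) (at z)"
        by simp
    qed
    have pc: "isCont p z" for z using p' DERIV_isCont by blast
    \<comment> \<open>The boundary terms disappear in the limit, which leaves the increments of
      \<open>V\<close>, that is, the integrals of \<open>q\<close> along the segments.\<close>
    have pg: "(\<lambda>n. p (b n) * g (b n) - p (a n) * g (a n)) \<longlonglongrightarrow> p B * 0 - p A * 0"
      by (intro tendsto_intros isCont_tendsto_compose[OF pc] lim ga gb)
    have V0: "(\<lambda>n. V (b n) - V (a n)) \<longlonglongrightarrow> 0"
      using tendsto_diff[OF pg W0] by (simp add: algebra_simps)
    let ?f = "\<lambda>n x. q (linepath (a n) (b n) x) * (b n - a n)"
    have int: "(?f n has_integral (V (b n) - V (a n))) {0<..<1}" for n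
    proof -
      have "path_image (linepath (a n) (b n)) \<subseteq> ball 0 1"
        using closed_segment_subset[OF ab(1) ab(2) convex_ball] by simp
      from contour_integral_primitive[OF V valid_path_linepath this]
      show ?thesis by (simp add: has_contour_integral_linepath has_integral_Icc_iff_Ioo)
    qed
    have N1: "norm A \<le> 1" using AB1 by simp
    have bq: "norm (q z) \<le> 2 ^ k * M" if "z \<in> ball 0 1" for z
    proof -
      have "norm (z - A) \<le> 2" using norm_triangle_ineq4[of z A] N1 that by simp
      then show ?thesis unfolding q_def norm_mult norm_power
        using M[OF that] by (intro mult_mono power_mono) auto
    qed
    \<comment> \<open>\<open>A\<close> and \<open>B\<close> may lie on the circle, where nothing is
      known about \<open>q\<close>; this is why the integrals are taken over the open
      interval.\<close>
    have ptw: "(\<lambda>n. ?f n x) \<longlonglongrightarrow> q (linepath A B x) * (B - A)" if x: "x \<in> {0<..<1}" for x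
    proof -
      have "isCont q (linepath A B x)"
        using hq seg[OF x] holomorphic_on_imp_continuous_on continuous_on_eq_continuous_at open_ball by blast
      moreover have "(\<lambda>n. linepath (a n) (b n) x) \<longlonglongrightarrow> linepath A B x"
        unfolding linepath_def by (intro tendsto_intros lim)
      ultimately show ?thesis
        by (intro tendsto_intros lim isCont_tendsto_compose[of _ q])
    qed
    have dom: "norm (?f n x) \<le> 2 ^ k * M * 2" if x: "x \<in> {0<..<1}" for n x
    proof -
      have "norm (b n - a n) \<le> 2"
        using norm_triangle_ineq4[of "b n" "a n"] ab[of n] by simp
      moreover have "norm (q (linepath (a n) (b n) x)) \<le> 2 ^ k * M"
        using x by (intro bq segn) auto
      ultimately show ?thesis unfolding norm_mult
        by (intro mult_mono) (auto intro: order_trans[OF norm_ge_zero])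
    qed
    have const: "(\<lambda>x::real. 2 ^ k * M * 2) integrable_on {0<..<1::real}"
      using has_integral_const_real[of "2 ^ k * M * 2" 0 1]
      unfolding has_integral_Icc_iff_Ioo by (rule has_integral_integrable)
    have int': "?f n integrable_on {0<..<1}" for n
      using int by (rule has_integral_integrable)
    have dc1: "(\<lambda>x. q (linepath A B x) * (B - A)) integrable_on {0<..<1}"
      by (rule dominated_convergence(1)[where f = ?f, OF int' const dom ptw])
    have dc2: "(\<lambda>n. integral {0<..<1} (?f n)) \<longlonglongrightarrow> integral {0<..<1} (\<lambda>x. q (linepath A B x) * (B - A))"
      by (rule dominated_convergence(2)[where f = ?f, OF int' const dom ptw])
    have "integral {0<..<1} (?f n) = V (b n) - V (a n)" for n
      by (rule integral_unique[OF int])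
    then have "(\<lambda>n. integral {0<..<1} (?f n)) \<longlonglongrightarrow> 0"
      using V0 by presburger
    then have "integral {0<..<1} (\<lambda>x. q (linepath A B x) * (B - A)) = 0"
      by (rule LIMSEQ_unique[OF dc2])
    then have "((\<lambda>x. q (linepath A B x) * (B - A)) has_integral 0) {0<..<1}"
      using integrable_integral[OF dc1] by (simp only:)
    \<comment> \<open>On the chord \<open>z - A\<close> is \<open>x * (B - A)\<close>. Its
      \<open>k\<close>-th power and the factor \<open>B - A\<close> from the path together account
      for the exponent \<open>Suc k\<close>.\<close>
    from has_integral_mult_right[OF this, of "1 / (B - A) ^ Suc k"]
    have "((\<lambda>x. 1 / (B - A) ^ Suc k * (q (linepath A B x) * (B - A))) has_integral 0) {0<..<1}"
      by simp
    moreover have "1 / (B - A) ^ Suc k * (q (linepath A B x) * (B - A)) = of_real x ^ k * u x" for x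
    proof -
      have "linepath A B x - A = of_real x * (B - A)"
        by (simp add: linepath_def scaleR_conv_of_real algebra_simps)
      then show ?thesis using AB by (simp add: q_def u_def power_mult_distrib)
    qed
    ultimately show ?thesis by simp
  qed
  have u0: "u x = 0" if x: "x \<in> {0<..<1}" for x
  proof (rule vanishing_moments[OF _ _ mom x])
    show "continuous_on {0<..<1} u"
      unfolding u_def
      by (rule continuous_on_compose2[OF cg continuous_on_linepath]) (use seg in \<open>auto simp del: mem_ball\<close>)
    show "norm (u x) \<le> M" if "x \<in> {0<..<1}" for x
      unfolding u_def by (rule M[OF seg[OF that]])
  qed
  show ?thesis
  proof (rule analytic_continuation[OF g open_ball connected_ball _ _ _ _ z])
    let ?U = "linepath A B ` {0<..<1}"
    show "?U \<subseteq> ball 0 1" using seg by blast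
    show "linepath A B (1/2) \<in> ball 0 1" by (rule seg) auto
    \<comment> \<open>A connected set with two distinct points has no isolated points, so the zeros
      of \<open>g\<close> accumulate at the midpoint; the quarter point only serves as the second
      point.\<close>
    have conn: "connected ?U"
      by (intro connected_continuous_image continuous_intros) auto
    have "linepath A B (1/2) \<in> ?U" "linepath A B (1/4) \<in> ?U" by auto
    moreover have "linepath A B (1/2) \<noteq> linepath A B (1/4)"
      using AB by (simp add: linepath_def scaleR_conv_of_real field_simps)
    ultimately show "linepath A B (1/2) islimpt ?U"
      using connected_imp_perfect[OF conn] by (metis singletonD)
    show "g w = 0" if "w \<in> ?U" for w using that u0 by (auto simp: u_def)
  qed
qed

section \<open>Joint continuity of complex derivatives in point and parameter\<close>

text \<open>Uniform limits of holomorphic functions may be differentiated. Joint continuity on a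
  compact disk supplies the uniformity.\<close>

lemma continuous_on_deriv_param:
  fixes f :: "'a::metric_space \<Rightarrow> complex \<Rightarrow> complex"
  assumes cont: "continuous_on (S \<times> T) (\<lambda>(z, t). f t z)"
    and holo: "\<And>t. t \<in> T \<Longrightarrow> f t holomorphic_on S"
    and S: "open S"
  shows "continuous_on (S \<times> T) (\<lambda>(z, t). deriv (f t) z)"
  unfolding continuous_on_eq_continuous_within
proof
  fix x0 assume x0: "x0 \<in> S \<times> T"
  then obtain R where R: "R > 0" "cball (fst x0) R \<subseteq> S"
    using S open_contains_cball by (metis mem_Times_iff)
  define r where "r = R / 2"
  have r: "r > 0" using R by (simp add: r_def)
  define X where "X = ball (fst x0) r \<times> T"
  \<comment> \<open>Translation moves the base point into the parameter \<open>x\<close>, so that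
    all derivatives are taken at the fixed point 0 of one common disk. Halving \<open>R\<close>
    leaves room for both the change of base point and \<open>w\<close>.\<close>
  define F where "F = (\<lambda>x w. f (snd x) (fst x + w))"
  have in_S: "fst x + w \<in> S" if "x \<in> X" "w \<in> cball 0 r" for x w
  proof -
    have "dist (fst x0) (fst x + w) \<le> dist (fst x0) (fst x) + norm w"
      using norm_triangle_ineq4[of "fst x0 - fst x" w] by (simp add: dist_norm algebra_simps)
    also have "\<dots> \<le> R" using that by (simp add: X_def mem_Times_iff r_def)
    finally show ?thesis using R by auto
  qed
  have x0X: "x0 \<in> X" using x0 r by (simp add: X_def mem_Times_iff)
  have XS: "X \<subseteq> S \<times> T"
    using in_S[of _ 0] r by (auto simp: X_def)
  have "continuous_on (X \<times> cball 0 r) (\<lambda>y. case (fst (fst y) + snd y, snd (fst y)) of (z, t) \<Rightarrow> f t z)"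
    by (rule continuous_on_compose2[OF cont])
       (use in_S in \<open>auto intro!: continuous_intros simp: X_def\<close>)
  then have contF: "continuous_on (X \<times> cball 0 r) (\<lambda>y. F (fst y) (snd y))"
    by (simp add: F_def)
  have ul: "uniform_limit (ball 0 r) F (F x0) (at x0 within X)"
  proof (rule uniform_limitI)
    fix e :: real assume e: "e > 0"
    then have "e / 2 > 0" by simp
    obtain X0 where X0: "x0 \<in> X0" "open X0"
      "\<forall>x\<in>X0 \<inter> X. \<forall>w\<in>cball 0 r. dist (F x w) (F x0 w) \<le> e / 2"
      using continuous_on_prod_compactE[OF contF compact_cball x0X \<open>e / 2 > 0\<close>] by auto
    have "eventually (\<lambda>x. x \<in> X0 \<inter> X) (at x0 within X)"
      using X0 by (auto simp: eventually_at_topological)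
    then show "eventually (\<lambda>x. \<forall>w\<in>ball 0 r. dist (F x w) (F x0 w) < e) (at x0 within X)"
    proof eventually_elim
      case (elim x)
      then have "dist (F x w) (F x0 w) \<le> e / 2" if "w \<in> ball 0 r" for w
        using X0(3) that ball_subset_cball by blast
      then show ?case using e by force
    qed
  qed
  have holF: "F x holomorphic_on ball 0 r" if "x \<in> X" for x
  proof -
    have "f (snd x) holomorphic_on S"
      using that holo by (auto simp: X_def)
    moreover have "(\<lambda>w. fst x + w) ` ball 0 r \<subseteq> S"
      using in_S[OF that] by (metis ball_subset_cball image_subsetI subsetD)
    ultimately have "(f (snd x) \<circ> (\<lambda>w. fst x + w)) holomorphic_on ball 0 r"
      by (intro holomorphic_on_compose_gen[of _ _ _ S] holomorphic_intros)
    then show ?thesis by (simp add: F_def o_def)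
  qed
  have dF: "deriv (F x) 0 = deriv (f (snd x)) (fst x)" if "x \<in> X" for x
  proof (rule DERIV_imp_deriv)
    have "x \<in> S \<times> T" using that XS by blast
    then have "(f (snd x) has_field_derivative deriv (f (snd x)) (fst x)) (at (fst x))"
      using holo S by (intro holomorphic_derivI) (auto simp: mem_Times_iff)
    then have "(f (snd x) has_field_derivative deriv (f (snd x)) (fst x)) (at (0 + fst x))"
      by simp
    then show "(F x has_field_derivative deriv (f (snd x)) (fst x)) (at 0)"
      unfolding DERIV_shift by (simp add: F_def add.commute)
  qed
  have "((\<lambda>x. deriv (f (snd x)) (fst x)) \<longlongrightarrow> deriv (f (snd x0)) (fst x0)) (at x0 within X)"
  proof (cases "at x0 within X = bot")
    case False
    have ev: "eventually (\<lambda>x. x \<in> X) (at x0 within X)"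
      by (simp add: eventually_at_topological) blast
    have "((\<lambda>x. deriv (F x) 0) \<longlongrightarrow> deriv (F x0) 0) (at x0 within X)"
      using r by (intro deriv_complex_uniform_limit[OF ul _ False open_ball] eventually_mono[OF ev holF]) auto
    then have "((\<lambda>x. deriv (F x) 0) \<longlongrightarrow> deriv (f (snd x0)) (fst x0)) (at x0 within X)"
      by (simp add: dF[OF x0X])
    then show ?thesis
      by (rule Lim_transform_eventually) (rule eventually_mono[OF ev dF])
  qed simp
  \<comment> \<open>Continuity is local: close to \<open>x0\<close> the sets \<open>X\<close> and
    \<open>S \<times> T\<close> coincide.\<close>
  moreover have "at x0 within X = at x0 within (S \<times> T)"
  proof (rule at_within_nhd)
    show "x0 \<in> ball (fst x0) r \<times> UNIV" "open (ball (fst x0) r \<times> (UNIV :: 'a set))"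
      using r by (auto simp: mem_Times_iff intro!: open_Times)
    show "X \<inter> ball (fst x0) r \<times> UNIV - {x0} = S \<times> T \<inter> ball (fst x0) r \<times> UNIV - {x0}"
      using XS by (auto simp: X_def)
  qed
  ultimately show "continuous (at x0 within S \<times> T) (\<lambda>(z, t). deriv (f t) z)"
    by (simp add: continuous_within case_prod_unfold)
qed

section \<open>Time integrals of the flow\<close>

text \<open>This is \<open>h\<close> of the overview. Integration smooths the flow, which is only
  assumed continuous in time. There is no division by \<open>a\<close>, so that integrals over
  adjacent time intervals add up.\<close>

definition orbit_integral :: "(real \<Rightarrow> complex \<Rightarrow> complex) \<Rightarrow> real \<Rightarrow> complex \<Rightarrow> complex" where
  "orbit_integral \<phi> a z = integral {0..a} (\<lambda>u. \<phi> u z)"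

context
  fixes \<phi> :: "real \<Rightarrow> complex \<Rightarrow> complex"
  assumes sg: "disk_semigroup \<phi>"
begin

lemma flow_in_disk: "t \<ge> 0 \<Longrightarrow> z \<in> unit_disk \<Longrightarrow> \<phi> t z \<in> unit_disk"
  using sg unfolding disk_semigroup_def by blast

lemma norm_flow_le: "t \<ge> 0 \<Longrightarrow> z \<in> unit_disk \<Longrightarrow> norm (\<phi> t z) \<le> 1"
  using flow_in_disk[of t z] by simp

lemma flow_holomorphic: "t \<ge> 0 \<Longrightarrow> \<phi> t holomorphic_on unit_disk"
  using sg unfolding disk_semigroup_def by blast

lemma flow_0: "z \<in> unit_disk \<Longrightarrow> \<phi> 0 z = z"
  using sg unfolding disk_semigroup_def by blast

lemma flow_add: "s \<ge> 0 \<Longrightarrow> t \<ge> 0 \<Longrightarrow> z \<in> unit_disk \<Longrightarrow> \<phi> (s + t) z = \<phi> s (\<phi> t z)"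
  using sg unfolding disk_semigroup_def by blast

lemma flow_continuous: "continuous_on ({0..} \<times> unit_disk) (\<lambda>(t, z). \<phi> t z)"
  using sg unfolding disk_semigroup_def by blast

lemma orbit_continuous:
  assumes "z \<in> unit_disk" "S \<subseteq> {0..}"
  shows "continuous_on S (\<lambda>t. \<phi> t z)"
proof -
  have "continuous_on S (\<lambda>t. case (t, z) of (t, z) \<Rightarrow> \<phi> t z)"
    by (rule continuous_on_compose2[OF flow_continuous]) (use assms in \<open>auto intro!: continuous_intros\<close>)
  then show ?thesis by simp
qed

lemma continuous_on_deriv_flow:
  "continuous_on (unit_disk \<times> {0..}) (\<lambda>(z, t). deriv (\<phi> t) z)"
proof (rule continuous_on_deriv_param)
  have "continuous_on (unit_disk \<times> {0..}) (\<lambda>y. case (snd y, fst y) of (t, z) \<Rightarrow> \<phi> t z)"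
    by (rule continuous_on_compose2[OF flow_continuous]) (auto intro!: continuous_intros)
  then show "continuous_on (unit_disk \<times> {0..}) (\<lambda>(z, t). \<phi> t z)"
    by (simp add: case_prod_beta)
qed (auto intro: flow_holomorphic)

lemma has_field_derivative_orbit_integral:
  assumes z: "z \<in> unit_disk"
  shows "(orbit_integral \<phi> a has_field_derivative integral {0..a} (\<lambda>u. deriv (\<phi> u) z)) (at z)"
proof -
  have "((\<lambda>z. integral (cbox 0 a) (\<lambda>u. \<phi> u z)) has_field_derivative
      integral (cbox 0 a) (\<lambda>u. deriv (\<phi> u) z)) (at z within unit_disk)"
  proof (rule leibniz_rule_field_derivative[OF _ _ _ z convex_ball])
    show "((\<lambda>z. \<phi> u z) has_field_derivative deriv (\<phi> u) w) (at w within unit_disk)"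
      if "w \<in> unit_disk" "u \<in> cbox 0 a" for w u
      using that holomorphic_derivI[OF flow_holomorphic open_ball that(1)]
      by (auto intro: has_field_derivative_at_within)
    show "(\<lambda>u. \<phi> u w) integrable_on cbox 0 a" if "w \<in> unit_disk" for w
      unfolding box_real by (intro integrable_continuous_real orbit_continuous that) auto
    show "continuous_on (unit_disk \<times> cbox 0 a) (\<lambda>(z, u). deriv (\<phi> u) z)"
      by (rule continuous_on_subset[OF continuous_on_deriv_flow]) auto
  qed
  then show ?thesis
    using at_within_open[OF z open_ball] by (simp add: orbit_integral_def[abs_def])
qed

lemma orbit_integral_holomorphic: "orbit_integral \<phi> a holomorphic_on unit_disk"
  using has_field_derivative_orbit_integral
  by (auto simp: holomorphic_on_open intro!: exI)

lemma norm_orbit_integral_le: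
  assumes "z \<in> unit_disk" "a \<ge> 0"
  shows "norm (orbit_integral \<phi> a z) \<le> a"
proof -
  have "norm (integral {0..a} (\<lambda>u. \<phi> u z)) \<le> 1 * (a - 0)"
    using assms by (intro integral_bound orbit_continuous norm_flow_le) auto
  then show ?thesis by (simp add: orbit_integral_def)
qed

text \<open>The derivative of \<open>\<phi> u\<close> at \<open>z\<close> is 1 for
  \<open>u = 0\<close> and continuous in \<open>u\<close>. For small \<open>a\<close> its integral
  over \<open>{0..a}\<close> is therefore within \<open>a / 2\<close> of \<open>a\<close>.\<close>

lemma deriv_orbit_integral_nonzero:
  assumes z: "z \<in> unit_disk"
  obtains a where "a > 0" "deriv (orbit_integral \<phi> a) z \<noteq> 0"
proof -
  have cont: "continuous_on {0..} (\<lambda>u. deriv (\<phi> u) z)"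
  proof -
    have "continuous_on {0..} (\<lambda>u. case (z, u) of (z, t) \<Rightarrow> deriv (\<phi> t) z)"
      by (rule continuous_on_compose2[OF continuous_on_deriv_flow])
        (use z in \<open>auto intro!: continuous_intros\<close>)
    then show ?thesis by simp
  qed
  have "((\<lambda>w. w) has_field_derivative 1) (at z)" by simp
  then have "(\<phi> 0 has_field_derivative 1) (at z)"
    by (rule has_field_derivative_transform_within_open[OF _ open_ball z]) (simp add: flow_0)
  then have d0: "deriv (\<phi> 0) z = 1" by (rule DERIV_imp_deriv)
  obtain d where d: "d > 0" "\<And>u. u \<in> {0..} \<Longrightarrow> dist u 0 < d \<Longrightarrow> dist (deriv (\<phi> u) z) (deriv (\<phi> 0) z) < 1 / 2"
    using continuous_on_iff[THEN iffD1, OF cont, rule_format, of 0 "1/2"] by auto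
  define a where "a = d / 2"
  have a: "a > 0" using d by (simp add: a_def)
  have cont': "continuous_on {0..a} (\<lambda>u. deriv (\<phi> u) z)"
    by (rule continuous_on_subset[OF cont]) auto
  have "norm (integral {0..a} (\<lambda>u. deriv (\<phi> u) z - 1)) \<le> 1 / 2 * (a - 0)"
  proof (rule integral_bound)
    show "norm (deriv (\<phi> u) z - 1) \<le> 1 / 2" if "u \<in> {0..a}" for u
      using d(2)[of u] that d(1) by (simp add: d0 dist_norm a_def)
  qed (use a in \<open>auto intro!: continuous_intros cont'\<close>)
  moreover have "integral {0..a} (\<lambda>u. deriv (\<phi> u) z - 1) = integral {0..a} (\<lambda>u. deriv (\<phi> u) z) - of_real a"
    using a by (subst integral_diff) (auto intro!: integrable_continuous_real cont' simp: scaleR_conv_of_real)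
  ultimately have "integral {0..a} (\<lambda>u. deriv (\<phi> u) z) \<noteq> 0"
    using a by auto
  then show ?thesis
    using that[OF a] DERIV_imp_deriv[OF has_field_derivative_orbit_integral[OF z, of a]] by simp
qed

text \<open>By the semigroup law, moving the base point for time \<open>s\<close> shifts the
  interval of integration to \<open>{s..a + s}\<close>.\<close>

lemma orbit_integral_flow:
  assumes z: "z \<in> unit_disk" and "s \<ge> 0" "a \<ge> 0"
  shows "orbit_integral \<phi> a (\<phi> s z) = orbit_integral \<phi> (a + s) z - orbit_integral \<phi> s z"
proof -
  have "orbit_integral \<phi> a (\<phi> s z) = integral {0..a} (\<lambda>u. \<phi> (u + s) z)"
    unfolding orbit_integral_def using assms by (intro integral_cong) (simp add: flow_add)
  also have "\<dots> = integral {s..a + s} (\<lambda>u. \<phi> u z)"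
    using integral_shift[of 0 s a "\<lambda>u. \<phi> u z"] assms by (simp add: o_def orbit_continuous)
  also have "\<dots> = integral {0..a + s} (\<lambda>u. \<phi> u z) - integral {0..s} (\<lambda>u. \<phi> u z)"
  proof -
    have "integral {0..s} (\<lambda>u. \<phi> u z) + integral {s..a + s} (\<lambda>u. \<phi> u z) = integral {0..a + s} (\<lambda>u. \<phi> u z)"
      using assms by (intro Henstock_Kurzweil_Integration.integral_combine integrable_continuous_real orbit_continuous) auto
    then show ?thesis by (simp add: algebra_simps)
  qed
  finally show ?thesis by (simp add: orbit_integral_def)
qed

lemma orbit_integral_has_vector_derivative:
  assumes z: "z \<in> unit_disk" and s: "s > 0"
  shows "((\<lambda>s. orbit_integral \<phi> s z) has_vector_derivative \<phi> s z) (at s)"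
proof -
  have "((\<lambda>s. integral {0..s} (\<lambda>u. \<phi> u z)) has_vector_derivative \<phi> s z) (at s within {0..s + 1})"
    using z s by (intro integral_has_vector_derivative orbit_continuous) auto
  moreover have "at s within {0..s + 1} = at s"
    using s by (intro at_within_interior) auto
  ultimately show ?thesis by (simp add: orbit_integral_def)
qed

text \<open>The fundamental theorem of calculus applies to both terms of
  \<open>orbit_integral_flow\<close>, so continuity of the orbit suffices; its differentiability is
  deduced from this afterwards.\<close>

lemma orbit_integral_flow_has_vector_derivative:
  assumes z: "z \<in> unit_disk" and s: "s > 0" and a: "a \<ge> 0"
  shows "((\<lambda>s. orbit_integral \<phi> a (\<phi> s z)) has_vector_derivative (\<phi> (a + s) z - \<phi> s z)) (at s)"
proof -
  have "((\<lambda>r. orbit_integral \<phi> r z) \<circ> (\<lambda>s. a + s) has_vector_derivative 1 *\<^sub>R \<phi> (a + s) z) (at s)"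
    using z s a
    by (intro vector_diff_chain_at orbit_integral_has_vector_derivative)
       (auto intro!: derivative_eq_intros)
  then have "((\<lambda>s. orbit_integral \<phi> (a + s) z - orbit_integral \<phi> s z) has_vector_derivative
      (\<phi> (a + s) z - \<phi> s z)) (at s)"
    using has_vector_derivative_diff[OF _ orbit_integral_has_vector_derivative[OF z s]]
    by (fastforce simp: o_def)
  then show ?thesis
    by (rule has_vector_derivative_transform_within_open[of _ _ _ "{0<..}"])
       (use z s a in \<open>auto simp: orbit_integral_flow\<close>)
qed

text \<open>
  Near \<open>\<phi> s z\<close> the flow is recovered from its time average by a holomorphic local inverse, and
  the time average is differentiable along orbits.
\<close>

lemma orbit_differentiable:
  assumes z: "z \<in> unit_disk" and s: "s > 0"
  obtains d where "((\<lambda>s. \<phi> s z) has_vector_derivative d) (at s)"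
proof -
  have fs: "\<phi> s z \<in> unit_disk" using z s by (intro flow_in_disk) auto
  obtain a where a: "a > 0" "deriv (orbit_integral \<phi> a) (\<phi> s z) \<noteq> 0"
    using deriv_orbit_integral_nonzero[OF fs] .
  let ?k = "orbit_integral \<phi> a"
  obtain r where r: "r > 0" "ball (\<phi> s z) r \<subseteq> unit_disk" "inj_on ?k (ball (\<phi> s z) r)"
    using has_complex_derivative_locally_injective[OF orbit_integral_holomorphic fs open_ball a(2)] .
  define g where "g = inv_into (ball (\<phi> s z) r) ?k"
  have g: "g (?k w) = w" if "w \<in> ball (\<phi> s z) r" for w
    using that r(3) by (simp add: g_def)
  have g': "(g has_field_derivative inverse (deriv ?k (\<phi> s z))) (at (?k (\<phi> s z)))"
  proof (rule has_field_derivative_inverse_strong[where f = ?k and x = "\<phi> s z" and S = "ball (\<phi> s z) r" and g = g])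
    show "(?k has_field_derivative deriv ?k (\<phi> s z)) (at (\<phi> s z))"
      by (rule holomorphic_derivI[OF orbit_integral_holomorphic open_ball fs])
    show "continuous_on (ball (\<phi> s z) r) ?k"
      using holomorphic_on_imp_continuous_on[OF orbit_integral_holomorphic] r(2) continuous_on_subset by blast
  qed (use r a(2) g in auto)
  \<comment> \<open>The local inverse \<open>g\<close> recovers the orbit at times when it is in the
    ball; \<open>U\<close> is an open set of such times around \<open>s\<close>.\<close>
  define U where "U = {0<..} \<inter> (\<lambda>s. \<phi> s z) -` ball (\<phi> s z) r"
  have "open U" unfolding U_def
    by (intro continuous_open_preimage orbit_continuous z) auto
  from field_vector_diff_chain_at[OF orbit_integral_flow_has_vector_derivative[OF z s] g']
  have "(g \<circ> (\<lambda>s. ?k (\<phi> s z)) has_vector_derivative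
      (\<phi> (a + s) z - \<phi> s z) * inverse (deriv ?k (\<phi> s z))) (at s)"
    using a by simp
  then have "((\<lambda>s. \<phi> s z) has_vector_derivative
      (\<phi> (a + s) z - \<phi> s z) * inverse (deriv ?k (\<phi> s z))) (at s)"
    by (rule has_vector_derivative_transform_within_open[OF _ \<open>open U\<close>])
       (use s r g in \<open>auto simp: U_def\<close>)
  then show ?thesis by (rule that)
qed

section \<open>Uniform convergence to the identity\<close>

text \<open>By the chain rule, \<open>W\<close> changes along an orbit at the rate
  \<open>p (\<phi> s z) * (\<phi> (a + s) z - \<phi> s z)\<close>, which is bounded by twice the
  maximum of \<open>p\<close> on the closed disk.\<close>

lemma primitive_lipschitz_along_orbits:
  assumes p: "p holomorphic_on UNIV" and a: "a \<ge> 0"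
    and W: "\<And>z. z \<in> unit_disk \<Longrightarrow>
      (W has_field_derivative p z * deriv (orbit_integral \<phi> a) z) (at z)"
  obtains K where "\<And>t z. t \<ge> 0 \<Longrightarrow> z \<in> unit_disk \<Longrightarrow> norm (W (\<phi> t z) - W z) \<le> K * t"
proof -
  have "continuous_on (cball 0 1) p"
    by (rule continuous_on_subset[OF holomorphic_on_imp_continuous_on[OF p]]) simp
  then have "bounded (p ` cball 0 1)"
    by (intro compact_imp_bounded compact_continuous_image compact_cball)
  then obtain B where B: "\<And>z. z \<in> cball 0 1 \<Longrightarrow> norm (p z) \<le> B"
    unfolding bounded_iff by blast
  have "norm (W (\<phi> t z) - W z) \<le> (B * 2) * t" if t: "t \<ge> 0" and z: "z \<in> unit_disk" for t z
  proof (cases "t = 0")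
    case True
    then show ?thesis using z by (simp add: flow_0)
  next
    case False
    let ?k = "orbit_integral \<phi> a"
    have contW: "continuous_on unit_disk W"
      by (intro continuous_at_imp_continuous_on ballI DERIV_isCont[OF W])
    \<comment> \<open>The mean value inequality asks for derivatives at interior times and for
      continuity at the ends. This fits, as orbits are shown to be differentiable for
      \<open>s > 0\<close>.\<close>
    have "norm (W (\<phi> t z) - W (\<phi> 0 z)) \<le> (B * 2) * t - (B * 2) * 0"
    proof (rule differentiable_bound_general[where f = "\<lambda>s. W (\<phi> s z)"
          and f' = "\<lambda>s. p (\<phi> s z) * (\<phi> (a + s) z - \<phi> s z)" and \<phi>' = "\<lambda>_. B * 2"])
      show "0 < t" using t False by simp
      show "continuous_on {0..t} (\<lambda>s. W (\<phi> s z))"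
        by (rule continuous_on_compose2[OF contW orbit_continuous[OF z]])
           (use z flow_in_disk in \<open>auto simp del: mem_ball\<close>)
      show "continuous_on {0..t} (\<lambda>x. B * 2 * x)" by (intro continuous_intros)
      show "((\<lambda>x. B * 2 * x) has_vector_derivative B * 2) (at s)" for s
        by (auto intro!: derivative_eq_intros)
      fix s assume s: "0 < s" "s < t"
      have fs: "\<phi> s z \<in> unit_disk" using z s by (intro flow_in_disk) auto
      obtain d where d: "((\<lambda>s. \<phi> s z) has_vector_derivative d) (at s)"
        using orbit_differentiable[OF z s(1)] .
      have "((\<lambda>s. ?k (\<phi> s z)) has_vector_derivative d * deriv ?k (\<phi> s z)) (at s)"
        using field_vector_diff_chain_at[OF d holomorphic_derivI[OF orbit_integral_holomorphic open_ball fs]]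
        by (simp add: o_def)
      \<comment> \<open>The unknown velocity \<open>d\<close> enters only through this product.
        Nothing is divided by \<open>deriv ?k\<close>, so its zeros do no harm.\<close>
      then have dk: "d * deriv ?k (\<phi> s z) = \<phi> (a + s) z - \<phi> s z"
        by (rule vector_derivative_unique_at[OF _ orbit_integral_flow_has_vector_derivative[OF z s(1) a]])
      have "((\<lambda>s. W (\<phi> s z)) has_vector_derivative d * (p (\<phi> s z) * deriv ?k (\<phi> s z))) (at s)"
        using field_vector_diff_chain_at[OF d W[OF fs]] by (simp add: o_def)
      then show "((\<lambda>s. W (\<phi> s z)) has_vector_derivative p (\<phi> s z) * (\<phi> (a + s) z - \<phi> s z)) (at s)"
        by (simp only: dk[symmetric] mult.left_commute[of d])
      have "norm (\<phi> (a + s) z - \<phi> s z) \<le> 1 + 1"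
        using a s z by (intro order_trans[OF norm_triangle_ineq4] add_mono norm_flow_le) auto
      moreover have Bs: "norm (p (\<phi> s z)) \<le> B" using fs by (intro B) auto
      moreover have "0 \<le> B" using Bs norm_ge_zero order_trans by blast
      ultimately show "norm (p (\<phi> s z) * (\<phi> (a + s) z - \<phi> s z)) \<le> B * 2"
        unfolding norm_mult by (intro mult_mono) auto
    qed
    then show ?thesis using z by (simp add: flow_0)
  qed
  then show ?thesis by (rule that)
qed

theorem flow_tendsto_id_uniformly:
  assumes e: "e > 0"
  obtains d where "d > 0" "\<And>t z. 0 \<le> t \<Longrightarrow> t < d \<Longrightarrow> z \<in> unit_disk \<Longrightarrow> norm (\<phi> t z - z) < e"
proof (rule ccontr)
  assume contra: "\<not> thesis"
  have "\<exists>t z. 0 \<le> t \<and> t < 1 / real (Suc n) \<and> z \<in> unit_disk \<and> e \<le> norm (\<phi> t z - z)" for n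
  proof (rule ccontr)
    assume "\<not> ?thesis"
    then have "\<And>t z. 0 \<le> t \<Longrightarrow> t < 1 / real (Suc n) \<Longrightarrow> z \<in> unit_disk \<Longrightarrow> norm (\<phi> t z - z) < e"
      by (meson not_le)
    moreover have "1 / real (Suc n) > 0" by simp
    ultimately show False using contra that by blast
  qed
  then obtain t z where tz: "\<And>n. 0 \<le> t n" "\<And>n. t n < 1 / real (Suc n)" "\<And>n. z n \<in> unit_disk"
      "\<And>n. e \<le> norm (\<phi> (t n) (z n) - z n)"
    by metis
  have z0: "(0::complex) \<in> unit_disk" by simp
  obtain a where a: "a > 0" "deriv (orbit_integral \<phi> a) 0 \<noteq> 0"
    using deriv_orbit_integral_nonzero[OF z0] .
  let ?h = "orbit_integral \<phi> a"
  \<comment> \<open>Compactness for triples yields one subsequence along which the starting points,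
    the moved points and the values of \<open>?h\<close> all converge.\<close>
  let ?C = "cball (0::complex) 1 \<times> cball (0::complex) 1 \<times> cball (0::complex) a"
  have "seq_compact ?C" by (intro compact_imp_seq_compact compact_Times compact_cball)
  moreover have "\<forall>n. (z n, \<phi> (t n) (z n), ?h (z n)) \<in> ?C"
    using tz(1,3) norm_flow_le norm_orbit_integral_le a(1) by (simp add: less_imp_le)
  ultimately obtain l r where lr: "strict_mono r"
      "((\<lambda>n. (z n, \<phi> (t n) (z n), ?h (z n))) \<circ> r) \<longlonglongrightarrow> l"
    by (rule seq_compactE)
  obtain A B c where l: "l = (A, B, c)" by (cases l)
  have limA: "(\<lambda>n. z (r n)) \<longlonglongrightarrow> A" and limB: "(\<lambda>n. \<phi> (t (r n)) (z (r n))) \<longlonglongrightarrow> B"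
    and limc: "(\<lambda>n. ?h (z (r n))) \<longlonglongrightarrow> c"
    using tendsto_fst[OF lr(2)] tendsto_fst[OF tendsto_snd[OF lr(2)]] tendsto_snd[OF tendsto_snd[OF lr(2)]]
    by (simp_all add: l o_def)
  have "e \<le> norm (B - A)"
    by (rule LIMSEQ_le_const[OF tendsto_norm[OF tendsto_diff[OF limB limA]]]) (use tz(4) in auto)
  then have AB: "A \<noteq> B" using e by auto
  have "t \<longlonglongrightarrow> 0"
    by (rule tendsto_sandwich[OF _ _ tendsto_const LIMSEQ_Suc[OF lim_1_over_n]])
       (use tz(1,2) in \<open>auto intro!: always_eventually less_imp_le simp del: of_nat_Suc\<close>)
  then have limt: "(\<lambda>n. t (r n)) \<longlonglongrightarrow> 0"
    using LIMSEQ_subseq_LIMSEQ[OF _ lr(1)] by (fastforce simp: o_def)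
  have W: "(\<lambda>n. W (\<phi> (t (r n)) (z (r n))) - W (z (r n))) \<longlonglongrightarrow> 0"
    if p: "p holomorphic_on UNIV"
      and W: "\<And>z. z \<in> unit_disk \<Longrightarrow> (W has_field_derivative p z * deriv ?h z) (at z)" for p W
  proof -
    obtain K where K: "\<And>t z. t \<ge> 0 \<Longrightarrow> z \<in> unit_disk \<Longrightarrow> norm (W (\<phi> t z) - W z) \<le> K * t"
      using primitive_lipschitz_along_orbits[OF p less_imp_le[OF a(1)] W] by blast
    show ?thesis
      by (rule Lim_null_comparison[OF _ tendsto_mult_right_zero[OF limt, of K]])
         (use K tz in \<open>auto intro!: always_eventually\<close>)
  qed
  have hd: "(?h has_field_derivative deriv ?h z) (at z)" if "z \<in> unit_disk" for z
    by (rule holomorphic_derivI[OF orbit_integral_holomorphic open_ball that])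
  \<comment> \<open>The case \<open>p = 1\<close>, with \<open>?h\<close> as its own primitive:
    \<open>?h\<close> has the same limit \<open>c\<close> along both sequences.\<close>
  have diff: "(\<lambda>n. ?h (\<phi> (t (r n)) (z (r n))) - ?h (z (r n))) \<longlonglongrightarrow> 0"
    by (rule W[of "\<lambda>_. 1"]) (use hd in auto)
  define g where "g = (\<lambda>z. ?h z - c)"
  have dg: "deriv g w = deriv ?h w" if "w \<in> unit_disk" for w
    unfolding g_def using hd[OF that] by (intro DERIV_imp_deriv) (auto intro!: derivative_eq_intros)
  have g0: "g w = 0" if w: "w \<in> unit_disk" for w
  proof (rule eq_0_if_vanishing_on_chord[OF _ _ _ _ limA limB AB _ _ _ w])
    show "g holomorphic_on unit_disk"
      unfolding g_def by (intro holomorphic_intros orbit_integral_holomorphic)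
    show "norm (g w) \<le> a + norm c" if "w \<in> unit_disk" for w
      unfolding g_def using norm_orbit_integral_le[OF that less_imp_le[OF a(1)]]
      by (intro order_trans[OF norm_triangle_ineq4]) simp
    show "z (r n) \<in> unit_disk" "\<phi> (t (r n)) (z (r n)) \<in> unit_disk" for n
      using tz flow_in_disk by blast+
    show "(\<lambda>n. g (z (r n))) \<longlonglongrightarrow> 0"
      unfolding g_def using tendsto_diff[OF limc tendsto_const[of c]] by simp
    show "(\<lambda>n. g (\<phi> (t (r n)) (z (r n)))) \<longlonglongrightarrow> 0"
      unfolding g_def using tendsto_diff[OF tendsto_add[OF diff limc] tendsto_const[of c]] by simp
    show "(\<lambda>n. V (\<phi> (t (r n)) (z (r n))) - V (z (r n))) \<longlonglongrightarrow> 0"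
      if "p holomorphic_on UNIV"
        "\<And>z. z \<in> unit_disk \<Longrightarrow> (V has_field_derivative p z * deriv g z) (at z)" for p V
      using that(2) by (intro W[OF that(1)]) (simp add: dg)
  qed
  have "((\<lambda>_. 0) has_field_derivative 0) (at (0::complex))" by simp
  then have "(g has_field_derivative 0) (at 0)"
    by (rule has_field_derivative_transform_within_open[OF _ open_ball z0]) (simp add: g0)
  then have "deriv ?h 0 = 0" using dg[OF z0] DERIV_imp_deriv[of g 0 0] by simp
  with a(2) show False by simp
qed

end

section \<open>Composition operators on the disk algebra\<close>

lemma comp_op_id: "comp_op \<phi> t (\<lambda>z. z) = \<phi> t"
  by (auto simp: comp_op_def)

lemma id_in_disk_algebra: "(\<lambda>z. z) \<in> disk_algebra"
  unfolding disk_algebra_def by (auto intro!: exI[of _ "\<lambda>z. z"] simp: image_ident)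

text \<open>The continuous extension of \<open>h\<close> maps the closed disk into itself, so the
  extensions can be composed.\<close>

lemma comp_in_disk_algebra:
  assumes f: "f \<in> disk_algebra" and h: "h \<in> disk_algebra" and sub: "h ` unit_disk \<subseteq> unit_disk"
  shows "f \<circ> h \<in> disk_algebra"
proof -
  obtain f' h' where f': "continuous_on (cball 0 1) f'" "\<And>z. z \<in> unit_disk \<Longrightarrow> f' z = f z"
    and h': "continuous_on (cball 0 1) h'" "\<And>z. z \<in> unit_disk \<Longrightarrow> h' z = h z"
    using f h unfolding disk_algebra_def by auto
  have "h' ` closure unit_disk \<subseteq> closure unit_disk"
  proof (rule image_closure_subset)
    show "continuous_on (closure unit_disk) h'" using h'(1) by simp
    show "h' ` unit_disk \<subseteq> closure unit_disk" using sub h'(2) closure_subset by fastforce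
  qed simp
  then have "continuous_on (cball 0 1) (\<lambda>z. f' (h' z))"
    by (intro continuous_on_compose2[OF f'(1) h'(1)]) simp
  moreover have "f' (h' z) = f (h z)" if "z \<in> unit_disk" for z
    using that sub h'(2) f'(2) by (simp add: image_subset_iff)
  moreover have "(f \<circ> h) holomorphic_on unit_disk"
    using f h sub by (intro holomorphic_on_compose_gen[where t = unit_disk]) (auto simp: disk_algebra_def)
  moreover have "(f \<circ> h) ` unit_disk \<subseteq> f ` unit_disk" using sub by auto
  then have "bounded ((f \<circ> h) ` unit_disk)"
    using disk_algebra_bounded[OF f] bounded_subset by blast
  ultimately show ?thesis unfolding disk_algebra_def by auto
qed

text \<open>The extension is continuous on the compact closed disk, hence uniformly continuous
  there.\<close>

lemma disk_algebra_uniformly_continuous: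
  assumes "f \<in> disk_algebra"
  shows "uniformly_continuous_on unit_disk f"
proof -
  obtain f' where f': "continuous_on (cball 0 1) f'" "\<And>z. z \<in> unit_disk \<Longrightarrow> f' z = f z"
    using assms unfolding disk_algebra_def by auto
  have "uniformly_continuous_on unit_disk f'"
    using compact_uniformly_continuous[OF f'(1) compact_cball] ball_subset_cball[of "0::complex" 1]
    unfolding uniformly_continuous_on_def by (meson subsetD)
  then show ?thesis
    unfolding uniformly_continuous_on_def using f'(2) by metis
qed

lemma disk_algebra_strongly_continuous:
  assumes sg: "disk_semigroup \<phi>" and f: "f \<in> disk_algebra"
  shows "((\<lambda>t. disk_norm (\<lambda>z. comp_op \<phi> t f z - f z)) \<longlongrightarrow> 0) (at_right 0)"
proof (rule tendstoI)
  fix e :: real assume "e > 0"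
  \<comment> \<open>Passing to the supremum weakens \<open><\<close> to \<open>\<le>\<close>;
    working with \<open>e / 2\<close> keeps the final bound strict.\<close>
  then have e2: "e / 2 > 0" by simp
  obtain \<delta> where \<delta>: "\<delta> > 0"
    "\<And>z w. z \<in> unit_disk \<Longrightarrow> w \<in> unit_disk \<Longrightarrow> dist w z < \<delta> \<Longrightarrow> dist (f w) (f z) < e / 2"
    using disk_algebra_uniformly_continuous[OF f] e2 unfolding uniformly_continuous_on_def by metis
  obtain d where d: "d > 0" "\<And>t z. 0 \<le> t \<Longrightarrow> t < d \<Longrightarrow> z \<in> unit_disk \<Longrightarrow> norm (\<phi> t z - z) < \<delta>"
    using flow_tendsto_id_uniformly[OF sg \<delta>(1)] by blast
  have "eventually (\<lambda>t. 0 < t \<and> t < d) (at_right 0)"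
    using d(1) by (auto simp: eventually_at_right_field)
  then show "eventually (\<lambda>t. dist (disk_norm (\<lambda>z. comp_op \<phi> t f z - f z)) 0 < e) (at_right 0)"
  proof eventually_elim
    case (elim t)
    have "disk_norm (\<lambda>z. comp_op \<phi> t f z - f z) \<le> e / 2"
    proof (rule disk_norm_least)
      fix z assume z: "z \<in> unit_disk"
      have "dist (f (\<phi> t z)) (f z) < e / 2"
        using elim z d(2) flow_in_disk[OF sg, of t z] by (intro \<delta>(2)) (auto simp: dist_norm)
      then show "norm (comp_op \<phi> t f z - f z) \<le> e / 2"
        by (simp add: comp_op_def dist_norm)
    qed
    moreover have "disk_norm (\<lambda>z. comp_op \<phi> t f z - f z) \<ge> 0"
      using elim by (intro disk_norm_nonneg bounded_comp_diff[OF sg _ f]) simp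
    ultimately show ?case using \<open>e > 0\<close> by (simp add: dist_norm)
  qed
qed

text \<open>Composition with \<open>\<phi> t\<close> takes the supremum over a subset of the disk,
  so \<open>K = 1\<close> serves. That \<open>\<phi> t\<close> lies in the algebra keeps the
  compositions in it.\<close>

lemma bounded_operator_comp_op:
  assumes sg: "disk_semigroup \<phi>" and t: "t \<ge> 0" and "\<phi> t \<in> disk_algebra"
  shows "bounded_operator_on_disk_algebra (comp_op \<phi> t)"
proof -
  have maps: "\<phi> t ` unit_disk \<subseteq> unit_disk"
    using flow_in_disk[OF sg t] by blast
  have "disk_norm (comp_op \<phi> t f) \<le> 1 * disk_norm f" if f: "f \<in> disk_algebra" for f
  proof (rule disk_norm_least)
    fix z assume "z \<in> unit_disk"
    then show "norm (comp_op \<phi> t f z) \<le> 1 * disk_norm f"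
      using disk_norm_upper[OF disk_algebra_bounded[OF f]] flow_in_disk[OF sg t]
      by (simp add: comp_op_def del: mem_ball)
  qed
  then have "\<exists>K. \<forall>f\<in>disk_algebra. disk_norm (comp_op \<phi> t f) \<le> K * disk_norm f" by blast
  moreover have "comp_op \<phi> t ` disk_algebra \<subseteq> disk_algebra"
    using comp_in_disk_algebra[OF _ assms(3) maps] by (auto simp: comp_op_def)
  ultimately show ?thesis
    unfolding bounded_operator_on_disk_algebra_def by (simp add: comp_op_def)
qed

theorem corollary1p5:
  fixes \<phi> :: "real \<Rightarrow> complex \<Rightarrow> complex"
  assumes "disk_semigroup \<phi>"
  shows "(\<forall>t\<ge>0. \<phi> t \<in> disk_algebra) \<longleftrightarrow>
    acts_on_disk_algebra \<phi> \<and> strong_continuity_space \<phi> = disk_algebra"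
proof
  assume "\<forall>t\<ge>0. \<phi> t \<in> disk_algebra"
  then have "acts_on_disk_algebra \<phi>"
    unfolding acts_on_disk_algebra_def using bounded_operator_comp_op[OF assms] by blast
  moreover have "strong_continuity_space \<phi> = disk_algebra"
    unfolding strong_continuity_space_eq[OF assms]
    using disk_algebra_strongly_continuous[OF assms] by blast
  ultimately show "acts_on_disk_algebra \<phi> \<and> strong_continuity_space \<phi> = disk_algebra" ..
next
  assume "acts_on_disk_algebra \<phi> \<and> strong_continuity_space \<phi> = disk_algebra"
  then have "comp_op \<phi> t (\<lambda>z. z) \<in> disk_algebra" if "t \<ge> 0" for t
    using that id_in_disk_algebra
    unfolding acts_on_disk_algebra_def bounded_operator_on_disk_algebra_def by blast
  then show "\<forall>t\<ge>0. \<phi> t \<in> disk_algebra" by (simp add: comp_op_id)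
qed

end
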